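(* Let $G$ be a finite nilpotent group (with $|G|$ not necessarily odd). Then $f(G)=f^*(|G|)$.
   Context: For a positive integer $n$, define $f^*(n)=n$ if $n$ is a power of $2$ (including $n=1$), and $f^*(n)=n(1-1/p)$ otherwise, where $p$ is the smallest odd prime factor of $n$. Explorer-Director game on a finite group $G$: a token starts at some given element $s\in G$ (which counts as visited). The game has perfect information and is played in rounds, with no limit on the number of rounds. In each round, if the token is at $x$, Explorer names an element $g\in G$, and then Director moves the token to either $xg$ or $xg^{-1}$, as Director chooses. Explorer wants to maximize, and Director to minimize, the number of distinct elements of $G$ ever visited by the token. $f(G)$ denotes the number of elements visited under optimal play, i.e. the largest $k$ such that Explorer has a strategy guaranteeing that at least $k$ distinct elements are visited; by left translation it does not depend on $s$. *)

theory Defs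
  imports Complex_Main "HOL-Algebra.Generated_Groups" "HOL-Computational_Algebra.Primes"
begin

definition f_star :: "nat \<Rightarrow> real" where
  "f_star n =
     (if \<exists>k. n = 2 ^ k then real n
      else real n * (1 - 1 / real (LEAST p. prime p \<and> odd p \<and> p dvd n)))"

primrec lower_central_series :: "('a, 'b) monoid_scheme \<Rightarrow> nat \<Rightarrow> 'a set" where
  "lower_central_series G 0 = carrier G"
| "lower_central_series G (Suc n) =
     generate G {x \<otimes>\<^bsub>G\<^esub> y \<otimes>\<^bsub>G\<^esub> inv\<^bsub>G\<^esub> x \<otimes>\<^bsub>G\<^esub> inv\<^bsub>G\<^esub> y | x y.
                   x \<in> lower_central_series G n \<and> y \<in> carrier G}"

definition nilpotent_group :: "('a, 'b) monoid_scheme \<Rightarrow> bool" where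
  "nilpotent_group G \<longleftrightarrow> group G \<and> (\<exists>n. lower_central_series G n = {\<one>\<^bsub>G\<^esub>})"

text \<open>A strategy of Explorer sees the whole list of positions so far, from the start to the
  current one, and returns the element to name. The positions record all the information there is:
  Explorer's own earlier choices are determined by the strategy, and Director's by the positions,
  up to which of two equal moves was made.\<close>

definition explorer_strategies :: "('a, 'b) monoid_scheme \<Rightarrow> ('a list \<Rightarrow> 'a) set" where
  "explorer_strategies G = {\<sigma>. \<forall>h \<in> lists (carrier G). \<sigma> h \<in> carrier G}"

text \<open>\<open>\<tau> n\<close> is the position of the token after \<open>n\<close> rounds; Director is unconstrained.\<close>

definition consistent_play ::
    "('a, 'b) monoid_scheme \<Rightarrow> 'a \<Rightarrow> ('a list \<Rightarrow> 'a) \<Rightarrow> (nat \<Rightarrow> 'a) \<Rightarrow> bool" where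
  "consistent_play G s \<sigma> \<tau> \<longleftrightarrow>
     \<tau> 0 = s \<and>
     (\<forall>n. let g = \<sigma> (map \<tau> [0..<Suc n])
          in \<tau> (Suc n) = \<tau> n \<otimes>\<^bsub>G\<^esub> g \<or> \<tau> (Suc n) = \<tau> n \<otimes>\<^bsub>G\<^esub> inv\<^bsub>G\<^esub> g)"

definition explorer_guarantees :: "('a, 'b) monoid_scheme \<Rightarrow> 'a \<Rightarrow> nat \<Rightarrow> bool" where
  "explorer_guarantees G s k \<longleftrightarrow>
     (\<exists>\<sigma> \<in> explorer_strategies G. \<forall>\<tau>. consistent_play G s \<sigma> \<tau> \<longrightarrow> k \<le> card (range \<tau>))"

text \<open>Meaningful for finite groups only, where the guaranteed numbers are bounded
  by the order of the group.\<close>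

definition visited_number :: "('a, 'b) monoid_scheme \<Rightarrow> 'a \<Rightarrow> nat" where
  "visited_number G s = (GREATEST k. explorer_guarantees G s k)"

end

theory Submission
  imports Defs "HOL-Algebra.Zassenhaus" "HOL-Algebra.Multiplicative_Group" "HOL-Number_Theory.Residues"
begin

text \<open>
  Director can keep the token out of a set \<open>Y\<close> exactly when \<open>Y\<close> is closed under midpoints:
  \<open>u g \<in> Y\<close> and \<open>u g\<^sup>-\<^sup>1 \<in> Y\<close> imply \<open>u \<in> Y\<close>. Conversely, Explorer can force the token into the
  midpoint closure of the unvisited set, step by step down to an unvisited element. Hence
  \<open>f(G) = |G| - |Y|\<close> for a largest proper midpoint-closed \<open>Y\<close>.

  In a nilpotent group a nonempty proper midpoint-closed set has at most \<open>|G|/q\<close> elements for some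
  odd prime \<open>q\<close> dividing \<open>|G|\<close>. To see this, descend along a central series with factors of prime order \<open>q\<close>.
  If \<open>q = 2\<close>, closedness makes \<open>Y\<close> a union of cosets of the larger term. If \<open>q\<close> is odd, the union of the
  cosets that meet \<open>Y\<close> is again midpoint-closed; when it is all of \<open>G\<close>, every coset meets \<open>Y\<close> in a single
  coset of the smaller term or lies in \<open>Y\<close>, and one coset inside \<open>Y\<close> would force \<open>Y = G\<close>. The bound is attained by a coset
  of a normal subgroup of index \<open>p\<close>, the smallest odd prime divisor of \<open>|G|\<close>.
\<close>

section \<open>The game and midpoint-closed sets\<close>

definition midpoint_closed :: "('a, 'b) monoid_scheme \<Rightarrow> 'a set \<Rightarrow> bool" where
  "midpoint_closed G Y \<longleftrightarrow> Y \<subseteq> carrier G \<and>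
     (\<forall>u \<in> carrier G. \<forall>g \<in> carrier G.
        u \<otimes>\<^bsub>G\<^esub> g \<in> Y \<longrightarrow> u \<otimes>\<^bsub>G\<^esub> inv\<^bsub>G\<^esub> g \<in> Y \<longrightarrow> u \<in> Y)"

text \<open>The positions from which Explorer can force a visit to \<open>U\<close> within
  \<open>n\<close> rounds, whatever Director answers.\<close>

primrec forcing_stage :: "('a, 'b) monoid_scheme \<Rightarrow> 'a set \<Rightarrow> nat \<Rightarrow> 'a set" where
  "forcing_stage G U 0 = U"
| "forcing_stage G U (Suc n) = forcing_stage G U n \<union>
     {u \<in> carrier G. \<exists>g \<in> carrier G. u \<otimes>\<^bsub>G\<^esub> g \<in> forcing_stage G U n \<and>
        u \<otimes>\<^bsub>G\<^esub> inv\<^bsub>G\<^esub> g \<in> forcing_stage G U n}"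

context group
begin

section \<open>Upper bound: Director stays outside a midpoint-closed set\<close>

lemma director_play:
  assumes X: "X \<subseteq> carrier G" "s \<in> X"
    and step: "\<And>x g. x \<in> X \<Longrightarrow> g \<in> carrier G \<Longrightarrow> x \<otimes> g \<in> X \<or> x \<otimes> inv g \<in> X"
    and \<sigma>: "\<sigma> \<in> explorer_strategies G"
  obtains \<tau> where "consistent_play G s \<sigma> \<tau>" "range \<tau> \<subseteq> X"
proof -
  \<comment> \<open>Director prefers the move by \<open>\<sigma> h\<close> and takes its inverse
    only if the first move leaves \<open>X\<close>; then \<open>step\<close> keeps the second one
    inside.\<close>
  define nxt where "nxt h = (if last h \<otimes> \<sigma> h \<in> X then last h \<otimes> \<sigma> h else last h \<otimes> inv (\<sigma> h))" for h
  \<comment> \<open>The recursion runs on whole histories because the named element depends on all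
    earlier positions; \<open>H n\<close> has \<open>n + 1\<close> entries.\<close>
  define H where "H n = ((\<lambda>h. h @ [nxt h]) ^^ n) [s]" for n
  define \<tau> where "\<tau> n = last (H n)" for n
  have H0: "H 0 = [s]" and HS: "H (Suc n) = H n @ [nxt (H n)]" for n
    by (simp_all add: H_def)
  have \<tau>0: "\<tau> 0 = s" and \<tau>S: "\<tau> (Suc n) = nxt (H n)" for n
    by (simp_all add: \<tau>_def H0 HS)
  have H_map: "H n = map \<tau> [0..<Suc n]" for n
    by (induction n) (simp_all add: H0 HS \<tau>0 \<tau>S)
  have HX: "H n \<noteq> [] \<and> set (H n) \<subseteq> X" for n
  proof (induction n)
    case 0
    then show ?case using X by (simp add: H0)
  next
    case (Suc n)
    then have "last (H n) \<in> X" and "\<sigma> (H n) \<in> carrier G"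
      using \<sigma> X last_in_set[of "H n"] unfolding explorer_strategies_def by (blast, auto)
    then have "nxt (H n) \<in> X"
      using step unfolding nxt_def by auto
    with Suc show ?case by (simp add: HS)
  qed
  have "consistent_play G s \<sigma> \<tau>"
    unfolding consistent_play_def Let_def H_map[symmetric]
    using \<tau>0 \<tau>S by (auto simp: nxt_def \<tau>_def)
  moreover have "range \<tau> \<subseteq> X"
    using HX last_in_set by (fastforce simp: \<tau>_def)
  ultimately show thesis by (rule that)
qed

lemma consistent_play_closed:
  assumes "consistent_play G s \<sigma> \<tau>" "\<sigma> \<in> explorer_strategies G" "s \<in> carrier G"
  shows "\<tau> n \<in> carrier G"
\<comment> \<open>A strategy is only known to name a group element on histories lying wholly in the
  carrier, so all earlier positions enter the induction.\<close>
proof (induction n rule: less_induct)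
  case (less n)
  show ?case
  proof (cases n)
    case 0
    then show ?thesis using assms by (simp add: consistent_play_def)
  next
    case (Suc m)
    have "map \<tau> [0..<Suc m] \<in> lists (carrier G)"
      using less Suc by auto
    then have "\<sigma> (map \<tau> [0..<Suc m]) \<in> carrier G"
      using assms(2) unfolding explorer_strategies_def by blast
    moreover have "\<tau> m \<in> carrier G" using less Suc by simp
    moreover have "\<tau> n = \<tau> m \<otimes> \<sigma> (map \<tau> [0..<Suc m]) \<or>
        \<tau> n = \<tau> m \<otimes> inv (\<sigma> (map \<tau> [0..<Suc m]))"
      using assms(1) unfolding consistent_play_def Let_def Suc by blast
    ultimately show ?thesis by auto
  qed
qed

text \<open>Read contrapositively, midpoint-closedness says that from outside \<open>Y\<close> at
  least one of the two moves stays outside, so Director can confine the token to the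
  complement.\<close>

lemma guarantee_upper:
  assumes "finite (carrier G)" "midpoint_closed G Y" "s \<in> carrier G" "s \<notin> Y"
    and "explorer_guarantees G s k"
  shows "k \<le> order G - card Y"
proof -
  obtain \<sigma> where \<sigma>: "\<sigma> \<in> explorer_strategies G"
    and k: "\<And>\<tau>. consistent_play G s \<sigma> \<tau> \<Longrightarrow> k \<le> card (range \<tau>)"
    using assms(5) unfolding explorer_guarantees_def by blast
  have Y: "Y \<subseteq> carrier G" using assms(2) by (simp add: midpoint_closed_def)
  obtain \<tau> where "consistent_play G s \<sigma> \<tau>" "range \<tau> \<subseteq> carrier G - Y"
  proof (rule director_play[where X = "carrier G - Y" and s = s and \<sigma> = \<sigma>])
    show "x \<otimes> g \<in> carrier G - Y \<or> x \<otimes> inv g \<in> carrier G - Y"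
      if "x \<in> carrier G - Y" "g \<in> carrier G" for x g
      using that assms(2) unfolding midpoint_closed_def by auto
  qed (use assms \<sigma> in auto)
  then have "k \<le> card (range \<tau>)" "card (range \<tau>) \<le> card (carrier G - Y)"
    using k assms(1) by (auto intro: card_mono)
  then show ?thesis
    using card_Diff_subset[OF finite_subset[OF Y assms(1)] Y] by (simp add: order_def)
qed

section \<open>Lower bound: Explorer forces the token to an unvisited element\<close>

lemma forcing_stage_mono: "m \<le> n \<Longrightarrow> forcing_stage G U m \<subseteq> forcing_stage G U n"
  by (rule lift_Suc_mono_le[of "forcing_stage G U"]) auto

text \<open>Two points of the union lie in a common stage by monotonicity, and any midpoint of them
  enters at the next one.\<close>

lemma midpoint_closed_forcing_stages:
  assumes "U \<subseteq> carrier G"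
  shows "midpoint_closed G (\<Union>n. forcing_stage G U n)"
  unfolding midpoint_closed_def
proof (intro conjI ballI impI)
  have "forcing_stage G U n \<subseteq> carrier G" for n
    using assms by (induction n) auto
  then show "(\<Union>n. forcing_stage G U n) \<subseteq> carrier G" by blast
next
  fix u g assume ug: "u \<in> carrier G" "g \<in> carrier G"
    and "u \<otimes> g \<in> (\<Union>n. forcing_stage G U n)" "u \<otimes> inv g \<in> (\<Union>n. forcing_stage G U n)"
  then obtain i j where ij: "u \<otimes> g \<in> forcing_stage G U i" "u \<otimes> inv g \<in> forcing_stage G U j"
    by blast
  have "u \<otimes> g \<in> forcing_stage G U (max i j)" "u \<otimes> inv g \<in> forcing_stage G U (max i j)"
    using ij forcing_stage_mono by (meson max.cobounded1 max.cobounded2 subsetD)+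
  then have "u \<in> forcing_stage G U (Suc (max i j))"
    using ug by auto
  then show "u \<in> (\<Union>n. forcing_stage G U n)" by blast
qed

text \<open>The first stage containing a position measures its distance from \<open>U\<close>. As
  \<open>x \<notin> U\<close>, this rank is a successor, and \<open>x\<close> entered that stage
  through an element both of whose moves end in an earlier one.\<close>

lemma forcing_move_exists:
  assumes "U \<subseteq> carrier G" "(\<Union>n. forcing_stage G U n) = carrier G" "x \<in> carrier G" "x \<notin> U"
  defines "r \<equiv> \<lambda>y. LEAST n. y \<in> forcing_stage G U n"
  shows "\<exists>g \<in> carrier G. r (x \<otimes> g) < r x \<and> r (x \<otimes> inv g) < r x"
proof -
  have "\<exists>n. x \<in> forcing_stage G U n" using assms by blast
  then have rx: "x \<in> forcing_stage G U (r x)" unfolding r_def by (rule LeastI_ex)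
  then obtain m where m: "r x = Suc m" using assms(4) by (cases "r x") auto
  then have "x \<notin> forcing_stage G U m"
    unfolding r_def by (metis lessI not_less_Least)
  then obtain g where "g \<in> carrier G" "x \<otimes> g \<in> forcing_stage G U m"
    "x \<otimes> inv g \<in> forcing_stage G U m"
    using rx unfolding m by auto
  moreover have "r y < r x" if "y \<in> forcing_stage G U m" for y
  proof -
    have "r y \<le> m" unfolding r_def using that by (rule Least_le)
    then show ?thesis using m by simp
  qed
  ultimately show ?thesis by blast
qed

text \<open>Explorer always lowers the rank with respect to the currently unvisited set. If too few
  elements were ever visited, this set would finally be constant with more than \<open>m\<close>
  elements, its midpoint closure would be the whole group, and the rank would fall forever.\<close>

lemma guarantee_lower:
  assumes fin: "finite (carrier G)" and s: "s \<in> carrier G"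
    and big: "\<And>Y. midpoint_closed G Y \<Longrightarrow> m < card Y \<Longrightarrow> Y = carrier G"
  shows "explorer_guarantees G s (order G - m)"
proof -
  define rk where "rk U y = (LEAST n. y \<in> forcing_stage G U n)" for U y
  define P where "P U x g \<longleftrightarrow> g \<in> carrier G \<and> rk U (x \<otimes> g) < rk U x \<and> rk U (x \<otimes> inv g) < rk U x"
    for U x g
  \<comment> \<open>The target is recomputed from the history in every round; the default
    \<open>\<one>\<close> keeps the strategy in the carrier where no rank-lowering element
    exists.\<close>
  define \<sigma> where "\<sigma> h = (let U = carrier G - set h
     in if \<exists>g. P U (last h) g then SOME g. P U (last h) g else \<one>)" for h
  have "\<sigma> h \<in> carrier G" for h
    unfolding \<sigma>_def Let_def using someI_ex[of "P (carrier G - set h) (last h)"]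
    by (metis P_def one_closed)
  then have \<sigma>: "\<sigma> \<in> explorer_strategies G"
    by (simp add: explorer_strategies_def)
  have "order G - m \<le> card (range \<tau>)" if play: "consistent_play G s \<sigma> \<tau>" for \<tau>
  proof (rule ccontr)
    assume few: "\<not> order G - m \<le> card (range \<tau>)"
    have \<tau>: "\<tau> n \<in> carrier G" for n
      using consistent_play_closed[OF play \<sigma> s] .
    then have fr: "finite (range \<tau>)"
      using fin by (meson finite_subset image_subsetI)
    define U where "U = carrier G - range \<tau>"
    have U: "U \<subseteq> carrier G" by (auto simp: U_def)
    have "card U = order G - card (range \<tau>)"
      unfolding U_def order_def using fr \<tau> by (intro card_Diff_subset) auto
    then have "m < card U" using few by linarith
    also have "card U \<le> card (\<Union>n. forcing_stage G U n)"
    proof (rule card_mono)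
      show "finite (\<Union>n. forcing_stage G U n)"
        using midpoint_closed_forcing_stages[OF U] fin
        unfolding midpoint_closed_def by (meson finite_subset)
      show "U \<subseteq> (\<Union>n. forcing_stage G U n)"
        by (metis UNIV_I UN_upper forcing_stage.simps(1))
    qed
    finally have full: "(\<Union>n. forcing_stage G U n) = carrier G"
      using big midpoint_closed_forcing_stages[OF U] by blast
    \<comment> \<open>Every element that is ever visited occurs before time \<open>M\<close>, so
      from then on the unvisited set is exactly \<open>U\<close>.\<close>
    obtain M where M: "range \<tau> \<subseteq> \<tau> ` {..<M}"
    proof -
      have "\<exists>C. finite C \<and> range \<tau> = \<tau> ` C"
        using finite_subset_image[OF fr, of \<tau> UNIV] by auto
      then obtain C where "finite C" "range \<tau> = \<tau> ` C" by blast
      moreover obtain M where "C \<subseteq> {..<M}"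
        using \<open>finite C\<close> by (auto simp: finite_nat_set_iff_bounded)
      ultimately show thesis using that by blast
    qed
    have less: "rk U (\<tau> (Suc n)) < rk U (\<tau> n)" if n: "M \<le> n" for n
    proof -
      have "\<tau> ` {..<M} \<subseteq> \<tau> ` {0..<Suc n}" using n by (intro image_mono) auto
      then have U': "carrier G - set (map \<tau> [0..<Suc n]) = U"
        using M unfolding U_def set_map set_upt by blast
      have "\<exists>g. P U (\<tau> n) g"
        unfolding P_def using forcing_move_exists[OF U full \<tau>[of n]]
        by (auto simp: U_def rk_def)
      then have "P U (\<tau> n) (\<sigma> (map \<tau> [0..<Suc n]))"
        unfolding \<sigma>_def U' Let_def by (auto intro: someI_ex)
      then show ?thesis
        using play unfolding consistent_play_def Let_def P_def by metis
    qed
    have "rk U (\<tau> (M + i)) + i \<le> rk U (\<tau> M)" for i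
    proof (induction i)
      case (Suc i)
      then show ?case using less[of "M + i"] by simp
    qed simp
    from this[of "Suc (rk U (\<tau> M))"] show False by simp
  qed
  with \<sigma> show ?thesis unfolding explorer_guarantees_def by blast
qed

text \<open>The two bounds meet: Director avoids \<open>Z\<close>, which misses the start, and
  Explorer profits from the absence of larger proper midpoint-closed sets.\<close>

lemma visited_number_eqI:
  assumes fin: "finite (carrier G)" and s: "s \<in> carrier G"
    and big: "\<And>Y. midpoint_closed G Y \<Longrightarrow> card Z < card Y \<Longrightarrow> Y = carrier G"
    and Z: "midpoint_closed G Z" "s \<notin> Z"
  shows "visited_number G s = order G - card Z"
  unfolding visited_number_def
  using guarantee_lower[OF fin s big] guarantee_upper[OF fin Z(1) s Z(2)]
  by (rule Greatest_equality)

end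

text \<open>Modulo an odd \<open>q\<close>, halving the distance to \<open>a\<close> sufficiently often doubles it.\<close>
lemma midpoint_closed_integers:
  fixes F :: "int set" and q :: nat
  assumes q: "prime q" "odd q"
    and mid: "\<And>i j k. i \<in> F \<Longrightarrow> j \<in> F \<Longrightarrow> [2 * k = i + j] (mod int q) \<Longrightarrow> k \<in> F"
    and ab: "a \<in> F" "b \<in> F" "\<not> int q dvd b - a"
  shows "k \<in> F"
proof -
  \<comment> \<open>Here \<open>k\<close> arises from \<open>x\<close> by \<open>t\<close> halvings
    of the distance to \<open>a\<close>. In the induction step \<open>k\<close> is the midpoint of
    \<open>a\<close> and \<open>a + 2 * (k - a)\<close>, which needs one halving fewer.\<close>
  have halve: "[2 ^ t * (k - a) = x - a] (mod int q) \<Longrightarrow> a \<in> F \<Longrightarrow> x \<in> F \<Longrightarrow> k \<in> F" for t k a x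
  proof (induction t arbitrary: k)
    case 0
    then have "[k = x] (mod int q)" by (simp add: cong_iff_dvd_diff)
    then have "[2 * k = x + x] (mod int q)"
      by (metis cong_scalar_left mult_2)
    then show ?case using mid 0 by blast
  next
    case (Suc t)
    have "[2 ^ t * (a + 2 * (k - a) - a) = x - a] (mod int q)"
      using Suc.prems(1) by (simp only: power_Suc2 mult.assoc add_diff_cancel_left')
    then have "a + 2 * (k - a) \<in> F" by (rule Suc.IH) (fact Suc.prems)+
    then show ?case
      using Suc.prems by (rule_tac mid[of "a + 2 * (k - a)" a]) simp_all
  qed
  \<comment> \<open>By Fermat, \<open>2 ^ (q - 2)\<close> is inverse to 2 modulo \<open>q\<close>,
    so \<open>q - 2\<close> halvings double the distance, which reflects \<open>a\<close> in
    \<open>x\<close>.\<close>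
  have double: "2 * x - a \<in> F" if "a \<in> F" "x \<in> F" for a x
  proof (rule halve[of "q - 2"])
    have "q > 2" using q prime_ge_2_nat[of q] by (cases "q = 2") auto
    have "\<not> q dvd 2" using \<open>q > 2\<close> by (auto dest: dvd_imp_le)
    then have "[2 ^ (q - 1) = 1] (mod q)" by (rule fermat_theorem[OF q(1)])
    then have "[2 ^ (q - 1) = 1] (mod int q)"
      by (metis cong_int_iff of_nat_1 of_nat_numeral of_nat_power)
    moreover have "2 ^ (q - 1) = 2 ^ (q - 2) * (2::int)"
      using \<open>q > 2\<close> by (simp flip: power_Suc2 add: Suc_diff_Suc numeral_2_eq_2)
    ultimately have "[2 ^ (q - 2) * 2 * (x - a) = 1 * (x - a)] (mod int q)"
      by (metis cong_scalar_right)
    then show "[2 ^ (q - 2) * (2 * x - a - a) = x - a] (mod int q)"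
      by (simp add: algebra_simps)
  qed (use that in auto)
  \<comment> \<open>Reflecting each term in its successor generates the arithmetic progression that
    starts with \<open>a\<close> and \<open>b\<close>.\<close>
  have steps: "a + int n * (b - a) \<in> F \<and> a + (int n + 1) * (b - a) \<in> F" for n
  proof (induction n)
    case (Suc n)
    then show ?case using double[of "a + int n * (b - a)" "a + (int n + 1) * (b - a)"]
      by (simp add: algebra_simps)
  qed (use ab in simp)
  have "coprime (b - a) (int q)"
    using q(1) ab(3) by (metis coprime_commute prime_imp_coprime prime_nat_int_transfer)
  then obtain v where v: "[(b - a) * v = 1] (mod int q)"
    using cong_solve_coprime_int by blast
  \<comment> \<open>As \<open>b - a\<close> is invertible modulo \<open>q\<close>, term
    \<open>n\<close> of the progression is congruent to \<open>k\<close>; \<open>halve\<close> with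
    exponent 0 then passes to \<open>k\<close> itself.\<close>
  define n where "n = nat ((v * (k - a)) mod int q)"
  have n: "int n = (v * (k - a)) mod int q"
    using q(1) by (simp add: n_def prime_gt_0_nat)
  have "[int n * (b - a) = (v * (k - a)) * (b - a)] (mod int q)"
    unfolding n by (intro cong_scalar_right) (simp add: cong_def)
  also have "(v * (k - a)) * (b - a) = ((b - a) * v) * (k - a)" by (simp add: algebra_simps)
  also have "[((b - a) * v) * (k - a) = 1 * (k - a)] (mod int q)"
    using v by (rule cong_scalar_right)
  finally have "[2 ^ 0 * (k - (a + int n * (b - a))) = (a + int n * (b - a)) - (a + int n * (b - a))] (mod int q)"
    by (simp add: cong_iff_dvd_diff dvd_diff_commute algebra_simps)
  then show ?thesis using halve steps by blast
qed

section \<open>Central elements modulo a normal subgroup\<close>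

text \<open>For normal \<open>N\<close>, the preimage of the centre of the quotient by
  \<open>N\<close>, written with the commutators of the lower central series.\<close>

definition central_mod :: "('a, 'b) monoid_scheme \<Rightarrow> 'a set \<Rightarrow> 'a set" where
  "central_mod G N = {w \<in> carrier G. \<forall>g \<in> carrier G. w \<otimes>\<^bsub>G\<^esub> g \<otimes>\<^bsub>G\<^esub> inv\<^bsub>G\<^esub> w \<otimes>\<^bsub>G\<^esub> inv\<^bsub>G\<^esub> g \<in> N}"

text \<open>One step up a central series, when \<open>w\<close> is central and of prime order modulo
  \<open>N\<close>.\<close>

definition adjoin :: "('a, 'b) monoid_scheme \<Rightarrow> 'a set \<Rightarrow> 'a \<Rightarrow> 'a set" where
  "adjoin G N w = N <#>\<^bsub>G\<^esub> generate G {w}"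

context group
begin

section \<open>Powers and commutators modulo a subgroup\<close>

lemma inv_cancel:
  assumes "x \<in> carrier G" "y \<in> carrier G"
  shows "inv x \<otimes> (x \<otimes> y) = y" "x \<otimes> (inv x \<otimes> y) = y"
  using assms by (simp_all flip: m_assoc)

lemma commute_mult:
  assumes "x \<otimes> g = g \<otimes> x" "y \<otimes> g = g \<otimes> y" "x \<in> carrier G" "y \<in> carrier G" "g \<in> carrier G"
  shows "(x \<otimes> y) \<otimes> g = g \<otimes> (x \<otimes> y)"
proof -
  have "(x \<otimes> y) \<otimes> g = x \<otimes> (g \<otimes> y)" using assms by (simp add: m_assoc)
  also have "\<dots> = (x \<otimes> g) \<otimes> y" using assms(3-5) by (simp add: m_assoc)
  also have "\<dots> = g \<otimes> (x \<otimes> y)" unfolding assms(1) using assms(3-5) by (simp add: m_assoc)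
  finally show ?thesis .
qed

lemma commute_inv:
  assumes "x \<otimes> g = g \<otimes> x" "x \<in> carrier G" "g \<in> carrier G"
  shows "inv x \<otimes> g = g \<otimes> inv x"
proof -
  have "inv x \<otimes> g = inv x \<otimes> ((g \<otimes> x) \<otimes> inv x)" using assms(2,3) by (simp add: m_assoc)
  also have "\<dots> = g \<otimes> inv x" unfolding assms(1)[symmetric]
    using assms(2,3) by (simp add: m_assoc inv_cancel)
  finally show ?thesis .
qed

text \<open>Prime factors of \<open>m\<close> are removed one at a time: with
  \<open>m = d * q\<close>, either \<open>v [^] d\<close> is the wanted power, or \<open>d\<close>
  takes the place of \<open>m\<close>. The value 1 is never reached, since
  \<open>v \<notin> N\<close>.\<close>

lemma prime_power_mod_subgroup:
  assumes N: "subgroup N G" and v: "v \<in> carrier G" "v \<notin> N" "v [^] m \<in> N" and m: "m > (0::nat)"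
  obtains k q :: nat where "prime q" "q dvd m" "v [^] k \<notin> N" "(v [^] k) [^] q \<in> N"
proof -
  have "\<exists>(k::nat) (q::nat). prime q \<and> q dvd m \<and> v [^] k \<notin> N \<and> (v [^] k) [^] q \<in> N"
    using m v(3)
  proof (induction m rule: less_induct)
    case (less m)
    have "m \<noteq> 1" using less v by auto
    then obtain q where q: "prime q" "q dvd m" using prime_factor_nat by blast
    then obtain d where d: "m = d * q" by (metis dvdE mult.commute)
    show ?case
    proof (cases "v [^] d \<in> N")
      case False
      moreover have "(v [^] d) [^] q \<in> N" using less.prems(2) v(1) d by (simp add: nat_pow_pow)
      ultimately show ?thesis using q False by (intro exI[of _ d] exI[of _ q]) simp
    next
      case True
      have "d < m" "d > 0" using d less.prems(1) prime_gt_1_nat[OF q(1)] by auto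
      then obtain k r where kr: "prime r" "r dvd d" "v [^] (k::nat) \<notin> N" "(v [^] k) [^] (r::nat) \<in> N"
        using less.IH True by blast
      moreover have "r dvd m" using kr(2) d by simp
      ultimately show ?thesis by blast
    qed
  qed
  then show thesis using that by blast
qed

lemma subgroup_int_pow: "subgroup N G \<Longrightarrow> a \<in> N \<Longrightarrow> a [^] (i::int) \<in> N"
  by (rule subgroup_int_pow_closed)

text \<open>By Bezout: the exponents that take \<open>a\<close> into \<open>N\<close> are closed
  under integer combinations.\<close>

lemma int_pow_gcd_mem:
  assumes N: "subgroup N G" and a: "a \<in> carrier G" "a [^] (i::int) \<in> N" "a [^] (j::int) \<in> N"
  shows "a [^] gcd i j \<in> N"
proof -
  obtain u v where "gcd i j = i * u + j * v" using bezout_int by (metis mult.commute)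
  then have "a [^] gcd i j = (a [^] i) [^] u \<otimes> (a [^] j) [^] v"
    using a(1) by (simp add: int_pow_mult int_pow_pow)
  then show ?thesis
    using subgroup_int_pow[OF N] a subgroup.m_closed[OF N] by simp
qed

lemma coprime_pow_mem:
  assumes "subgroup N G" "a \<in> carrier G" "a [^] (m::nat) \<in> N" "a [^] (n::nat) \<in> N" "coprime m n"
  shows "a \<in> N"
  using int_pow_gcd_mem[OF assms(1,2), of "int m" "int n"] assms by (simp add: int_pow_int)

lemma int_pow_mem_iff_dvd:
  assumes N: "subgroup N G" and w: "w \<in> carrier G" "w \<notin> N" "w [^] q \<in> N" and q: "prime (q::nat)"
  shows "w [^] (i::int) \<in> N \<longleftrightarrow> int q dvd i"
proof
  assume "w [^] i \<in> N"
  then have "w [^] gcd i (int q) \<in> N" using w by (intro int_pow_gcd_mem[OF N]) (simp_all add: int_pow_int)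
  then have "gcd i (int q) \<noteq> 1" using w by auto
  then show "int q dvd i"
    using q by (metis coprime_iff_gcd_eq_1 coprime_commute prime_imp_coprime prime_nat_int_transfer)
next
  assume "int q dvd i"
  then obtain j where "i = int q * j" by blast
  then have "w [^] i = (w [^] int q) [^] j" using w by (simp add: int_pow_pow)
  then show "w [^] i \<in> N" using subgroup_int_pow[OF N] w by (simp add: int_pow_int)
qed

lemma prime_dvd_order:
  assumes "subgroup N G" "w \<in> carrier G" "w \<notin> N" "w [^] q \<in> N" "prime (q::nat)"
  shows "q dvd order G"
  using int_pow_mem_iff_dvd[OF assms, of "int (order G)"] assms(2) subgroup.one_closed[OF assms(1)]
  by (simp add: int_pow_int pow_order_eq_1)

lemma r_coset_eq_iff:
  assumes "subgroup N G" "a \<in> carrier G" "b \<in> carrier G"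
  shows "N #> a = N #> b \<longleftrightarrow> a \<otimes> inv b \<in> N"
  using assms by (metis inv_closed coset_join1 coset_join2 m_closed subgroup.subset
      coset_mult_inv1 coset_mult_inv2)

lemma central_mod_iff:
  assumes N: "N \<lhd> G"
  shows "w \<in> central_mod G N \<longleftrightarrow>
    w \<in> carrier G \<and> (\<forall>g \<in> carrier G. N #> w <#> (N #> g) = N #> g <#> (N #> w))"
proof -
  interpret N: normal N G by (fact N)
  have "w \<otimes> g \<otimes> inv w \<otimes> inv g \<in> N \<longleftrightarrow> N #> w <#> (N #> g) = N #> g <#> (N #> w)"
    if "w \<in> carrier G" "g \<in> carrier G" for w g
    using that r_coset_eq_iff[OF N.subgroup_axioms, of "w \<otimes> g" "g \<otimes> w"]
    by (simp add: N.rcos_sum inv_mult_group m_assoc)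
  then show ?thesis unfolding central_mod_def by blast
qed

text \<open>In the quotient, what commutes with a fixed coset is closed under products and
  inverses.\<close>

lemma subgroup_central_mod:
  assumes N: "N \<lhd> G"
  shows "subgroup (central_mod G N) G"
proof -
  interpret N: normal N G by (fact N)
  interpret Q: group "G Mod N" by (rule N.factorgroup_is_group)
  let ?r = "\<lambda>a. N #> a"
  have r: "?r a \<in> carrier (G Mod N)" if "a \<in> carrier G" for a
    using that by (auto simp: FactGroup_def RCOSETS_def)
  have mult: "?r (a \<otimes> b) = ?r a \<otimes>\<^bsub>G Mod N\<^esub> ?r b" if "a \<in> carrier G" "b \<in> carrier G" for a b
    using that by (simp add: N.rcos_sum)
  have iff: "w \<in> central_mod G N \<longleftrightarrow> w \<in> carrier G \<and>
      (\<forall>g \<in> carrier G. ?r w \<otimes>\<^bsub>G Mod N\<^esub> ?r g = ?r g \<otimes>\<^bsub>G Mod N\<^esub> ?r w)" for w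
    using central_mod_iff[OF N] by simp
  show ?thesis
  proof
    show "central_mod G N \<subseteq> carrier G" by (auto simp: central_mod_def)
    show "\<one> \<in> central_mod G N"
      by (auto simp: central_mod_def)
  next
    fix a b assume a: "a \<in> central_mod G N" and b: "b \<in> central_mod G N"
    then have ab: "a \<in> carrier G" "b \<in> carrier G" by (auto simp: central_mod_def)
    show "a \<otimes> b \<in> central_mod G N"
      unfolding iff
    proof (intro conjI ballI)
      fix g assume g: "g \<in> carrier G"
      have "?r a \<otimes>\<^bsub>G Mod N\<^esub> ?r b \<otimes>\<^bsub>G Mod N\<^esub> ?r g = ?r g \<otimes>\<^bsub>G Mod N\<^esub> (?r a \<otimes>\<^bsub>G Mod N\<^esub> ?r b)"
        by (rule Q.commute_mult) (use a b g iff r in blast)+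
      then show "?r (a \<otimes> b) \<otimes>\<^bsub>G Mod N\<^esub> ?r g = ?r g \<otimes>\<^bsub>G Mod N\<^esub> ?r (a \<otimes> b)"
        unfolding mult[OF ab] .
    qed (use ab in simp)
  next
    fix a assume a: "a \<in> central_mod G N"
    then have ac: "a \<in> carrier G" by (simp add: central_mod_def)
    show "inv a \<in> central_mod G N"
      unfolding iff
    proof (intro conjI ballI)
      fix g assume g: "g \<in> carrier G"
      have inv: "?r (inv a) = inv\<^bsub>G Mod N\<^esub> ?r a"
        using N.inv_FactGroup[OF r[OF ac]] N.rcos_inv[OF ac] by simp
      show "?r (inv a) \<otimes>\<^bsub>G Mod N\<^esub> ?r g = ?r g \<otimes>\<^bsub>G Mod N\<^esub> ?r (inv a)"
        unfolding inv by (rule Q.commute_inv) (use a g iff r in blast)+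
    qed (use ac in simp)
  qed
qed

lemma normal_subset_central_mod:
  assumes "N \<lhd> G"
  shows "N \<subseteq> central_mod G N"
proof
  interpret N: normal N G by (fact assms)
  fix n assume n: "n \<in> N"
  show "n \<in> central_mod G N"
    unfolding central_mod_def
  proof (intro CollectI conjI ballI)
    fix g assume "g \<in> carrier G"
    then show "n \<otimes> g \<otimes> inv n \<otimes> inv g \<in> N"
      using n N.inv_op_closed2[of g "inv n"] N.mem_carrier by (simp add: m_assoc)
  qed (use n N.mem_carrier in simp)
qed

text \<open>The commutator stands to the left of \<open>g \<otimes> w\<close>; conjugation by
  \<open>g \<otimes> w\<close> brings it to the right, where sets closed under right multiplication
  by \<open>N\<close> absorb it.\<close>

lemma central_mod_swap:
  assumes N: "N \<lhd> G" and w: "w \<in> central_mod G N" and g: "g \<in> carrier G"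
  obtains n where "n \<in> N" "w \<otimes> g = g \<otimes> w \<otimes> n"
proof -
  interpret N: normal N G by (fact N)
  have wc: "w \<in> carrier G" and c: "w \<otimes> g \<otimes> inv w \<otimes> inv g \<in> N"
    using w g by (auto simp: central_mod_def)
  define c where "c = w \<otimes> g \<otimes> inv w \<otimes> inv g"
  have cc: "c \<in> carrier G" using wc g by (simp add: c_def)
  have "inv (g \<otimes> w) \<otimes> c \<otimes> (g \<otimes> w) \<in> N"
    using wc g c by (intro N.inv_op_closed1) (auto simp: c_def)
  moreover have "c \<otimes> (g \<otimes> w) = w \<otimes> g"
    using wc g by (simp add: c_def m_assoc inv_cancel)
  then have "w \<otimes> g = g \<otimes> w \<otimes> (inv (g \<otimes> w) \<otimes> c \<otimes> (g \<otimes> w))"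
    using wc g cc by (simp add: m_assoc inv_mult_group inv_cancel)
  ultimately show thesis using that by blast
qed

text \<open>A conjugate of \<open>h\<close> differs from \<open>h\<close> by a commutator, which
  lies in \<open>N\<close> and hence in \<open>M\<close>.\<close>

lemma normal_between:
  assumes N: "N \<lhd> G" and M: "subgroup M G" "N \<subseteq> M" "M \<subseteq> central_mod G N"
  shows "M \<lhd> G"
  unfolding normal_inv_iff
proof (intro conjI ballI)
  fix g h assume g: "g \<in> carrier G" and h: "h \<in> M"
  have hc: "h \<in> carrier G" by (rule subgroup.mem_carrier[OF M(1) h])
  have "h \<in> central_mod G N" by (rule subsetD[OF M(3) h])
  then have "h \<otimes> g \<otimes> inv h \<otimes> inv g \<in> M"
    using g M(2) by (auto simp: central_mod_def)
  then have "inv (h \<otimes> g \<otimes> inv h \<otimes> inv g) \<in> M"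
    by (rule subgroup.m_inv_closed[OF M(1)])
  then have "inv (h \<otimes> g \<otimes> inv h \<otimes> inv g) \<otimes> h \<in> M"
    using h M(1) by (simp add: subgroup.m_closed)
  then show "g \<otimes> h \<otimes> inv g \<in> M"
    using g hc by (simp add: m_assoc inv_mult_group)
qed (fact M(1))


section \<open>Adjoining a central element to a normal subgroup\<close>

lemma mem_adjoin_iff:
  assumes "w \<in> carrier G"
  shows "a \<in> adjoin G N w \<longleftrightarrow> (\<exists>n \<in> N. \<exists>i::int. a = n \<otimes> w [^] i)"
  unfolding adjoin_def set_mult_def generate_pow[OF assms] by blast

lemma subset_adjoin:
  assumes "subgroup N G" "w \<in> carrier G"
  shows "N \<subseteq> adjoin G N w" "w \<in> adjoin G N w"
proof -
  show "N \<subseteq> adjoin G N w"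
  proof
    fix n assume n: "n \<in> N"
    then have "n = n \<otimes> w [^] (0::int)"
      using subgroup.mem_carrier[OF assms(1)] by simp
    then show "n \<in> adjoin G N w" unfolding mem_adjoin_iff[OF assms(2)] using n by blast
  qed
  have "w = \<one> \<otimes> w [^] (1::int)" using assms(2) by simp
  then show "w \<in> adjoin G N w"
    unfolding mem_adjoin_iff[OF assms(2)] using subgroup.one_closed[OF assms(1)] by blast
qed

lemma adjoin_subset_central_mod:
  assumes N: "N \<lhd> G" and w: "w \<in> central_mod G N"
  shows "adjoin G N w \<subseteq> central_mod G N"
proof
  have wc: "w \<in> carrier G" using w by (simp add: central_mod_def)
  note sub = subgroup_central_mod[OF N]
  fix a assume "a \<in> adjoin G N w"
  then obtain n i where a: "n \<in> N" "a = n \<otimes> w [^] (i::int)"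
    unfolding mem_adjoin_iff[OF wc] by blast
  show "a \<in> central_mod G N"
    unfolding a(2)
    using normal_subset_central_mod[OF N] a(1) subgroup_int_pow[OF sub w]
    by (intro subgroup.m_closed[OF sub]) auto
qed

lemma normal_adjoin:
  assumes N: "N \<lhd> G" and w: "w \<in> central_mod G N"
  shows "adjoin G N w \<lhd> G"
proof (rule normal_between[OF N])
  have wc: "w \<in> carrier G" using w by (simp add: central_mod_def)
  show "subgroup (adjoin G N w) G"
    unfolding adjoin_def using wc by (intro mult_norm_subgroup[OF N] generate_is_subgroup) simp
  show "N \<subseteq> adjoin G N w"
    using subset_adjoin(1)[OF normal_imp_subgroup[OF N] wc] .
qed (rule adjoin_subset_central_mod[OF N w])

text \<open>Since \<open>w\<close> has order exactly \<open>q\<close> modulo \<open>N\<close>, each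
  element has a unique form \<open>n \<otimes> w [^] i\<close> with
  \<open>0 \<le> i < q\<close>.\<close>

lemma card_adjoin:
  assumes N: "subgroup N G"
    and w: "w \<in> carrier G" "w \<notin> N" "w [^] q \<in> N" and q: "prime (q::nat)"
  shows "card (adjoin G N w) = q * card N"
proof -
  let ?f = "\<lambda>(n, i::int). n \<otimes> w [^] i"
  have Nc: "n \<in> carrier G" if "n \<in> N" for n using subgroup.mem_carrier[OF N that] .
  have "inj_on ?f (N \<times> {0..<int q})"
  proof (rule inj_onI, clarsimp)
    fix n n' and i j :: int
    assume *: "n \<in> N" "n' \<in> N" "0 \<le> i" "i < int q" "0 \<le> j" "j < int q"
      and eq: "n \<otimes> w [^] i = n' \<otimes> w [^] j"
    have "w [^] (i - j) = w [^] i \<otimes> inv (w [^] j)" using w(1) by (simp add: int_pow_diff)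
    also have "w [^] i = inv n \<otimes> (n' \<otimes> w [^] j)"
      unfolding eq[symmetric] using Nc * w(1) by (simp add: inv_cancel)
    also have "\<dots> \<otimes> inv (w [^] j) = inv n \<otimes> n'"
      using Nc * w(1) by (simp add: m_assoc)
    finally have "w [^] (i - j) \<in> N"
      using * subgroup.m_closed[OF N] subgroup.m_inv_closed[OF N] by simp
    then have "int q dvd i - j" using int_pow_mem_iff_dvd[OF N w q] by simp
    then have "i = j"
      using * by (metis mod_eq_dvd_iff mod_pos_pos_trivial)
    then show "n = n' \<and> i = j" using eq Nc * w(1) by simp
  qed
  moreover have "?f ` (N \<times> {0..<int q}) = adjoin G N w"
  proof (intro equalityI subsetI)
    fix a assume "a \<in> adjoin G N w"
    then obtain n i where n: "n \<in> N" and a: "a = n \<otimes> w [^] (i::int)"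
      unfolding mem_adjoin_iff[OF w(1)] by blast
    have "w [^] i = w [^] (int q * (i div int q)) \<otimes> w [^] (i mod int q)"
      using w(1) by (simp flip: int_pow_mult)
    then have "a = (n \<otimes> w [^] (int q * (i div int q))) \<otimes> w [^] (i mod int q)"
      using a w(1) Nc[OF n] by (simp add: m_assoc)
    moreover have "n \<otimes> w [^] (int q * (i div int q)) \<in> N"
      using n int_pow_mem_iff_dvd[OF N w q] by (simp add: subgroup.m_closed[OF N])
    moreover have "i mod int q \<in> {0..<int q}" using prime_gt_0_nat[OF q] by simp
    ultimately show "a \<in> ?f ` (N \<times> {0..<int q})" by force
  qed (auto simp: mem_adjoin_iff[OF w(1)])
  ultimately have "card (adjoin G N w) = card (N \<times> {0..<int q})"
    by (metis card_image)
  then show ?thesis by (simp add: card_cartesian_product mult.commute)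
qed

section \<open>Normal subgroups of prime index in nilpotent groups\<close>

lemma nilpotent_central_mod:
  assumes "nilpotent_group G" and N: "N \<lhd> G" "N \<noteq> carrier G"
  obtains x where "x \<in> central_mod G N" "x \<notin> N"
proof -
  let ?L = "lower_central_series G"
  obtain c where c: "?L c = {\<one>}" using assms(1) by (auto simp: nilpotent_group_def)
  have sub: "subgroup N G" using N(1) by (rule normal_imp_subgroup)
  have "\<not> ?L 0 \<subseteq> N" using N(2) subgroup.subset[OF sub] by auto
  moreover have "?L c \<subseteq> N" using c subgroup.one_closed[OF sub] by simp
  \<comment> \<open>The lower central series enters \<open>N\<close> after term \<open>k\<close>. An
    element of that term outside \<open>N\<close> has all its commutators in the next term, hence in
    \<open>N\<close>.\<close>
  ultimately obtain k where k: "\<not> ?L k \<subseteq> N" "?L (Suc k) \<subseteq> N"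
    using ex_least_nat_less[of "\<lambda>n. ?L n \<subseteq> N" c] by (metis Suc_eq_plus1 order_refl)
  have Lc: "?L n \<subseteq> carrier G" for n
  proof (induction n)
    case (Suc n)
    then show ?case by (auto intro!: generate_incl simp del: generate_incl)
  qed simp
  obtain x where x: "x \<in> ?L k" "x \<notin> N" using k(1) by blast
  have "x \<otimes> g \<otimes> inv x \<otimes> inv g \<in> ?L (Suc k)" if "g \<in> carrier G" for g
    using x(1) that by (auto intro!: generate.incl)
  then have "x \<in> central_mod G N"
    using x(1) Lc k(2) by (auto simp: central_mod_def)
  then show thesis using that x(2) by blast
qed

text \<open>Lagrange in the quotient, whose order is the index of \<open>N\<close>.\<close>

lemma pow_index_mem:
  assumes N: "N \<lhd> G" and fin: "finite (carrier G)" and a: "a \<in> carrier G"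
  shows "a [^] (order G div card N) \<in> N"
proof -
  interpret N: normal N G by (fact N)
  interpret Q: group "G Mod N" by (rule N.factorgroup_is_group)
  have "card N > 0"
    using N.subset fin N.one_closed by (metis card_gt_0_iff empty_iff finite_subset)
  then have "order (G Mod N) = order G div card N"
    using lagrange[OF N.subgroup_axioms] by (simp add: order_def FactGroup_def)
      (metis nonzero_mult_div_cancel_right less_irrefl order_def)
  moreover have "(N #> a) [^]\<^bsub>G Mod N\<^esub> order (G Mod N) = \<one>\<^bsub>G Mod N\<^esub>"
    using a by (intro Q.pow_order_eq_1) (auto simp: FactGroup_def RCOSETS_def)
  ultimately have "N #> a [^] (order G div card N) = N"
    using a by (simp add: N.FactGroup_pow)
  then show ?thesis
    using coset_join1[OF _ _ N.subgroup_axioms] a by simp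
qed

text \<open>Each factor \<open>y\<close> that passes \<open>g\<close> leaves one factor
  \<open>c\<close>, which commutes with \<open>y\<close> and is collected in front.\<close>

lemma commute_up_to_central_pow:
  assumes "y \<otimes> g = c \<otimes> (g \<otimes> y)" "y \<otimes> c = c \<otimes> y" "y \<in> carrier G" "g \<in> carrier G" "c \<in> carrier G"
  shows "y [^] (k::nat) \<otimes> g = c [^] k \<otimes> (g \<otimes> y [^] k)"
proof (induction k)
  case (Suc k)
  have yc: "y \<otimes> c [^] k = c [^] k \<otimes> y"
    using assms by (metis group_commutes_pow)
  have "y [^] Suc k \<otimes> g = y \<otimes> (y [^] k \<otimes> g)"
    using assms by (simp only: nat_pow_Suc2 m_assoc nat_pow_closed)
  also have "\<dots> = (y \<otimes> c [^] k) \<otimes> (g \<otimes> y [^] k)"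
    unfolding Suc using assms by (simp add: m_assoc)
  also have "\<dots> = c [^] k \<otimes> ((y \<otimes> g) \<otimes> y [^] k)"
    unfolding yc using assms(3-5) by (simp add: m_assoc)
  also have "\<dots> = c [^] Suc k \<otimes> (g \<otimes> y [^] Suc k)"
    unfolding assms(1) nat_pow_Suc2[OF assms(3)] nat_pow_Suc[of c]
    using assms(3-5) by (simp add: m_assoc)
  finally show ?case .
qed (use assms in simp)

text \<open>Modulo \<open>N\<close>, \<open>a\<close> is a power of \<open>w\<close>, so
  \<open>a [^] q\<close> is a power of \<open>w [^] q\<close>.\<close>

lemma adjoin_pow_mem:
  assumes N: "N \<lhd> G" and w: "w \<in> carrier G" "w [^] (q::nat) \<in> N" and a: "a \<in> adjoin G N w"
  shows "a [^] q \<in> N"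
proof -
  interpret N: normal N G by (fact N)
  obtain n i where n: "n \<in> N" and a: "a = n \<otimes> w [^] (i::int)"
    using a unfolding mem_adjoin_iff[OF w(1)] by blast
  have ac: "a \<in> carrier G" using a w n N.mem_carrier by simp
  have "N #> a = N #> w [^] i"
    unfolding a using n w(1) N.mem_carrier
    by (simp add: coset_join2 N.subgroup_axioms N.subset flip: coset_mult_assoc)
  then have "N #> a [^] q = N #> (w [^] i) [^] q"
    using ac w(1) by (simp flip: N.FactGroup_pow)
  also have "(w [^] i) [^] q = (w [^] q) [^] i"
    using w(1) by (simp add: int_pow_pow mult.commute flip: int_pow_int)
  also have "N #> (w [^] q) [^] i = N"
    using w subgroup_int_pow[OF N.subgroup_axioms] by (intro coset_join2 N.subgroup_axioms) auto
  finally show ?thesis using coset_join1[OF _ _ N.subgroup_axioms] ac by simp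
qed

text \<open>The commutator \<open>c\<close> of \<open>y\<close> and \<open>g\<close> lies in
  \<open>adjoin G N w\<close>, so it is central modulo \<open>N\<close> and
  \<open>c [^] q \<in> N\<close>. Moving \<open>y [^] m\<close> past \<open>g\<close> produces
  \<open>c [^] m\<close> modulo \<open>N\<close>; but \<open>y [^] m\<close> is itself central
  modulo \<open>N\<close>, so \<open>c [^] m \<in> N\<close>. Coprimality gives
  \<open>c \<in> N\<close>.\<close>

lemma central_mod_descend:
  assumes N: "N \<lhd> G" and w: "w \<in> central_mod G N" "w [^] (q::nat) \<in> N"
    and y: "y \<in> central_mod G (adjoin G N w)" "y [^] (m::nat) \<in> adjoin G N w" and mq: "coprime m q"
  shows "y \<in> central_mod G N"
  unfolding central_mod_def
proof (intro CollectI conjI ballI)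
  interpret N: normal N G by (fact N)
  interpret Q: group "G Mod N" by (rule N.factorgroup_is_group)
  let ?r = "\<lambda>a. N #> a"
  have wc: "w \<in> carrier G" and yc: "y \<in> carrier G" using w y by (simp_all add: central_mod_def)
  show "y \<in> carrier G" by (fact yc)
  have r: "?r a \<in> carrier (G Mod N)" if "a \<in> carrier G" for a
    using that by (auto simp: FactGroup_def RCOSETS_def)
  have mult: "?r (a \<otimes> b) = ?r a \<otimes>\<^bsub>G Mod N\<^esub> ?r b" if "a \<in> carrier G" "b \<in> carrier G" for a b
    using that by (simp add: N.rcos_sum)
  have comm: "?r a \<otimes>\<^bsub>G Mod N\<^esub> ?r b = ?r b \<otimes>\<^bsub>G Mod N\<^esub> ?r a"
    if "a \<in> adjoin G N w" "b \<in> carrier G" for a b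
    using that adjoin_subset_central_mod[OF N w(1)] central_mod_iff[OF N] by auto
  fix g assume g: "g \<in> carrier G"
  define c where "c = y \<otimes> g \<otimes> inv y \<otimes> inv g"
  have c: "c \<in> adjoin G N w" and cc: "c \<in> carrier G"
    using y(1) g by (auto simp: c_def central_mod_def)
  have "y \<otimes> g = c \<otimes> (g \<otimes> y)"
    using yc g by (simp add: c_def m_assoc inv_cancel)
  then have "?r y \<otimes>\<^bsub>G Mod N\<^esub> ?r g = ?r c \<otimes>\<^bsub>G Mod N\<^esub> (?r g \<otimes>\<^bsub>G Mod N\<^esub> ?r y)"
    using yc g cc by (simp only: m_closed flip: mult)
  from Q.commute_up_to_central_pow[OF this comm[OF c yc, symmetric] r[OF yc] r[OF g] r[OF cc], of m]
  have "?r (y [^] m) \<otimes>\<^bsub>G Mod N\<^esub> ?r g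
      = ?r (c [^] m) \<otimes>\<^bsub>G Mod N\<^esub> (?r g \<otimes>\<^bsub>G Mod N\<^esub> ?r (y [^] m))"
    unfolding N.FactGroup_pow[OF yc] N.FactGroup_pow[OF cc] .
  then have "\<one>\<^bsub>G Mod N\<^esub> = ?r (c [^] m)"
    unfolding comm[OF y(2) g] using yc g cc r Q.r_cancel_one'[of "?r g \<otimes>\<^bsub>G Mod N\<^esub> ?r (y [^] m)" "?r (c [^] m)"]
    by (metis Q.m_closed nat_pow_closed)
  then have "c [^] m \<in> N"
    using coset_join1[OF _ _ N.subgroup_axioms] cc by simp
  then show "y \<otimes> g \<otimes> inv y \<otimes> inv g \<in> N"
    using coprime_pow_mem[OF N.subgroup_axioms cc _ adjoin_pow_mem[OF N wc w(2) c] mq]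
    by (simp add: c_def)
qed

text \<open>Let \<open>N\<close> be largest among the normal subgroups with index divisible by
  \<open>p\<close>. Then an element central and of prime order modulo \<open>N\<close> has order
  \<open>p\<close>; adjoining one leaves an index prime to \<open>p\<close>, and this index turns
  out to be 1.\<close>

lemma nilpotent_normal_index_prime:
  assumes nil: "nilpotent_group G" and fin: "finite (carrier G)"
    and p: "prime p" "p dvd order G"
  obtains M where "M \<lhd> G" "p * card M = order G"
proof -
  define S where "S = {N. N \<lhd> G \<and> p * card N dvd order G}"
  have "S \<subseteq> Pow (carrier G)"
    by (auto simp: S_def dest!: normal_imp_subgroup subgroup.subset)
  then have finS: "finite S" using fin by (simp add: finite_subset)
  have "{\<one>} \<in> S" using p(2) one_is_normal by (simp add: S_def)
  then have "Max (card ` S) \<in> card ` S" using finS by (intro Max_in) auto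
  then obtain N where "N \<in> S" and "card N = Max (card ` S)" by force
  then have N: "N \<lhd> G" and pN: "p * card N dvd order G"
    and max: "\<And>M. M \<in> S \<Longrightarrow> card M \<le> card N"
    using finS by (auto simp: S_def)
  interpret N: normal N G by (fact N)
  have cardN: "card N > 0"
    using N.subset fin N.one_closed by (metis card_gt_0_iff empty_iff finite_subset)
  have ord: "order G > 0" using fin by (simp add: order_gt_0_iff_finite)
  \<comment> \<open>Adjoining an element of another prime order \<open>q\<close> would enlarge
    \<open>N\<close> while keeping the index divisible by \<open>p\<close>.\<close>
  have eq_p: "q = p" if w: "w \<in> central_mod G N" "w \<notin> N" "w [^] q \<in> N" and q: "prime q" for w q
  proof (rule ccontr)
    assume "q \<noteq> p"
    have wc: "w \<in> carrier G" using w by (simp add: central_mod_def)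
    have card: "card (adjoin G N w) = q * card N"
      using card_adjoin[OF N.subgroup_axioms wc w(2,3) q] .
    have norm: "adjoin G N w \<lhd> G" using normal_adjoin[OF N w(1)] .
    then have "q * card N dvd order G"
      using lagrange normal_imp_subgroup card by (metis dvd_triv_right)
    moreover obtain t where t: "order G = card N * t" using pN by (metis dvd_mult_right dvdE)
    ultimately have "q dvd t" "p dvd t"
      using pN cardN by (simp_all add: mult.commute)
    moreover have "coprime q p" using q p(1) \<open>q \<noteq> p\<close> by (rule primes_coprime)
    ultimately have "q * p dvd t" by (rule divides_mult)
    then have "adjoin G N w \<in> S"
      using norm by (simp add: S_def card t mult.commute mult.left_commute)
    then show False using max card cardN prime_gt_1_nat[OF q] by fastforce
  qed
  have "N \<noteq> carrier G"
    using pN ord prime_gt_1_nat[OF p(1)] by (auto simp: order_def dest!: dvd_imp_le)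
  then obtain x where x: "x \<in> central_mod G N" "x \<notin> N"
    using nilpotent_central_mod[OF nil N] by blast
  then have xc: "x \<in> carrier G" by (simp add: central_mod_def)
  have pow_central: "a [^] (k::nat) \<in> central_mod G N" if "a \<in> central_mod G N" for a k
    using subgroup_int_pow[OF subgroup_central_mod[OF N] that, of "int k"] by (simp add: int_pow_int)
  have "x [^] order G \<in> N" using xc by (simp add: pow_order_eq_1)
  then obtain k q where "prime q" "x [^] (k::nat) \<notin> N" "(x [^] k) [^] (q::nat) \<in> N"
    using prime_power_mod_subgroup[OF N.subgroup_axioms xc x(2) _ ord] by blast
  then obtain w where w: "w \<in> central_mod G N" "w \<notin> N" "w [^] p \<in> N"
    using eq_p pow_central[OF x(1)] by blast
  have wc: "w \<in> carrier G" using w by (simp add: central_mod_def)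
  define N' where "N' = adjoin G N w"
  have N': "N' \<lhd> G" unfolding N'_def by (rule normal_adjoin[OF N w(1)])
  then have subN': "subgroup N' G" by (rule normal_imp_subgroup)
  have cardN': "card N' = p * card N"
    unfolding N'_def by (rule card_adjoin[OF N.subgroup_axioms wc w(2,3) p(1)])
  define m where "m = order G div card N'"
  have m: "order G = m * card N'"
    using pN by (simp add: m_def cardN')
  have "m > 0" using m ord by (cases m) auto
  have "\<not> p dvd m"
  proof
    assume "p dvd m"
    then have "N' \<in> S" using N' m by (auto simp: S_def)
    then show False
      using max cardN' cardN prime_gt_1_nat[OF p(1)] by fastforce
  qed
  then have cop: "coprime m p" using p(1) by (metis coprime_commute prime_imp_coprime)
  have "N' = carrier G"
  proof (rule ccontr)
    assume "N' \<noteq> carrier G"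
    then obtain y where y: "y \<in> central_mod G N'" "y \<notin> N'"
      using nilpotent_central_mod[OF nil N'] by blast
    have yc: "y \<in> carrier G" using y by (simp add: central_mod_def)
    have ym: "y [^] m \<in> N'"
      unfolding m_def by (rule pow_index_mem[OF N' fin yc])
    have yN: "y \<in> central_mod G N"
      using central_mod_descend[OF N w(1,3) _ _ cop] y ym by (simp add: N'_def)
    \<comment> \<open>The power \<open>p\<close> takes \<open>y [^] m\<close>, an element of
      \<open>N'\<close>, into \<open>N\<close>, so \<open>v [^] m \<in> N\<close>; yet
      \<open>v\<close> stays outside \<open>N'\<close> because \<open>m\<close> and \<open>p\<close>
      are coprime. A power of \<open>v\<close> then has a prime order dividing \<open>m\<close>
      modulo \<open>N\<close>, against \<open>eq_p\<close>.\<close>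
    define v where "v = y [^] p"
    have vc: "v \<in> carrier G" and v: "v \<in> central_mod G N"
      using yc pow_central[OF yN] by (simp_all add: v_def)
    have "v \<notin> N'" using coprime_pow_mem[OF subN' yc ym _ cop] y(2) by (auto simp: v_def)
    then have vN: "v \<notin> N" using subset_adjoin(1)[OF N.subgroup_axioms wc] by (auto simp: N'_def)
    have "v [^] m = (y [^] m) [^] p" using yc by (simp add: v_def nat_pow_pow mult.commute)
    then have "v [^] m \<in> N"
      using adjoin_pow_mem[OF N wc w(3)] ym by (simp add: N'_def)
    then obtain k q where "prime q" "q dvd m" "v [^] (k::nat) \<notin> N" "(v [^] k) [^] (q::nat) \<in> N"
      using prime_power_mod_subgroup[OF N.subgroup_axioms vc vN _ \<open>m > 0\<close>] by blast
    then show False using eq_p pow_central[OF v] \<open>\<not> p dvd m\<close> by blast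
  qed
  then show thesis using that[OF N] cardN' by (simp add: order_def)
qed


section \<open>The size of midpoint-closed sets\<close>

text \<open>\<open>Y\<close> is a union of left cosets of \<open>N\<close> and so absorbs the
  correction from \<open>central_mod_swap\<close>.\<close>

lemma saturated_swap:
  assumes N: "N \<lhd> G" and Y: "Y \<subseteq> carrier G" "\<forall>y \<in> Y. \<forall>n \<in> N. y \<otimes> n \<in> Y"
    and w: "w \<in> central_mod G N" and a: "a \<in> carrier G" and b: "b \<in> carrier G"
  shows "a \<otimes> w \<otimes> b \<in> Y \<longleftrightarrow> a \<otimes> b \<otimes> w \<in> Y"
proof -
  interpret N: normal N G by (fact N)
  have wc: "w \<in> carrier G" using w by (simp add: central_mod_def)
  obtain n where n: "n \<in> N" "w \<otimes> b = b \<otimes> w \<otimes> n" using central_mod_swap[OF N w b] by blast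
  have eq: "a \<otimes> w \<otimes> b = a \<otimes> b \<otimes> w \<otimes> n"
    using n(2) wc a b N.mem_carrier[OF n(1)] by (simp add: m_assoc)
  then have eq': "a \<otimes> b \<otimes> w = a \<otimes> w \<otimes> b \<otimes> inv n"
    using wc a b N.mem_carrier[OF n(1)] by (simp add: m_assoc)
  show ?thesis
  proof
    assume "a \<otimes> w \<otimes> b \<in> Y"
    then have "a \<otimes> w \<otimes> b \<otimes> inv n \<in> Y" using Y(2) n(1) N.m_inv_closed by blast
    then show "a \<otimes> b \<otimes> w \<in> Y" using eq' by simp
  next
    assume "a \<otimes> b \<otimes> w \<in> Y"
    then show "a \<otimes> w \<otimes> b \<in> Y" unfolding eq using Y(2) n(1) by blast
  qed
qed

text \<open>Midpoints along powers of \<open>x\<close> are midpoints of exponents modulo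
  \<open>q\<close>. From \<open>u \<otimes> x [^] k\<close>, the moves by
  \<open>g \<otimes> x [^] (i - k)\<close> and its inverse lead, up to \<open>N\<close>, to
  \<open>u \<otimes> g \<otimes> x [^] i\<close> and
  \<open>u \<otimes> inv g \<otimes> x [^] (2 * k - i)\<close>, and \<open>2 * k - i\<close> is
  congruent to \<open>j\<close>.\<close>

lemma saturated_midpoint:
  assumes N: "N \<lhd> G" and Y: "midpoint_closed G Y" "\<forall>y \<in> Y. \<forall>n \<in> N. y \<otimes> n \<in> Y"
    and x: "x \<in> central_mod G N" "x [^] (q::nat) \<in> N"
    and ug: "u \<in> carrier G" "g \<in> carrier G"
    and i: "u \<otimes> g \<otimes> x [^] (i::int) \<in> Y" and j: "u \<otimes> inv g \<otimes> x [^] (j::int) \<in> Y"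
    and k: "[2 * k = i + j] (mod int q)"
  shows "u \<otimes> x [^] k \<in> Y"
proof -
  interpret N: normal N G by (fact N)
  have xc: "x \<in> carrier G" using x by (simp add: central_mod_def)
  have xpow: "x [^] l \<in> central_mod G N" for l :: int
    using subgroup_int_pow[OF subgroup_central_mod[OF N] x(1)] .
  have Yc: "Y \<subseteq> carrier G" using Y(1) by (simp add: midpoint_closed_def)
  define l where "l = i - k"
  have "u \<otimes> (g \<otimes> x [^] l) \<otimes> x [^] k = u \<otimes> g \<otimes> x [^] i"
    using xc ug by (simp add: m_assoc l_def flip: int_pow_mult)
  then have *: "u \<otimes> x [^] k \<otimes> (g \<otimes> x [^] l) \<in> Y"
    using saturated_swap[OF N Yc Y(2) xpow] i xc ug by simp
  obtain t where t: "2 * k - (i + j) = int q * t"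
    using k by (auto simp: cong_iff_dvd_diff)
  have "u \<otimes> inv g \<otimes> x [^] (k - l) = u \<otimes> inv g \<otimes> x [^] j \<otimes> (x [^] q) [^] t"
  proof -
    have "k - l = j + int q * t" using t by (simp add: l_def)
    then show ?thesis
      using xc ug by (simp add: m_assoc int_pow_mult int_pow_pow flip: int_pow_int)
  qed
  also have "\<dots> \<in> Y"
    using j Y(2) subgroup_int_pow[OF N.subgroup_axioms x(2)] by blast
  finally have "u \<otimes> x [^] (k - l) \<otimes> inv g \<in> Y"
    using saturated_swap[OF N Yc Y(2) xpow] xc ug by simp
  moreover have "u \<otimes> x [^] (k - l) \<otimes> inv g = u \<otimes> x [^] k \<otimes> inv (g \<otimes> x [^] l)"
    using xc ug by (simp add: m_assoc inv_mult_group int_pow_diff)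
  moreover have "u \<otimes> x [^] k \<in> carrier G" "g \<otimes> x [^] l \<in> carrier G"
    using xc ug by simp_all
  ultimately show ?thesis
    using * Y(1) unfolding midpoint_closed_def by metis
qed

text \<open>The point \<open>y \<otimes> x\<close> is a midpoint of \<open>y\<close> and
  \<open>y \<otimes> x [^] 2\<close>, and the latter is in \<open>Y\<close> by saturation.\<close>

lemma saturated_involution:
  assumes N: "N \<lhd> G" and Y: "midpoint_closed G Y" "\<forall>y \<in> Y. \<forall>n \<in> N. y \<otimes> n \<in> Y"
    and x: "x \<in> carrier G" "x [^] (2::nat) \<in> N"
    and y: "y \<in> Y" and a: "a \<in> adjoin G N x"
  shows "y \<otimes> a \<in> Y"
proof -
  interpret N: normal N G by (fact N)
  have Yc: "y \<in> carrier G" if "y \<in> Y" for y using Y(1) that by (auto simp: midpoint_closed_def)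
  have step: "y \<otimes> x \<in> Y" if "y \<in> Y" for y
  proof -
    have "y \<otimes> x \<otimes> inv x \<in> Y" using that x Yc by (simp add: m_assoc)
    moreover have "y \<otimes> x \<otimes> inv (inv x) \<in> Y"
      using bspec[OF bspec[OF Y(2) that] x(2)] x(1) Yc[OF that] by (simp add: m_assoc numeral_2_eq_2)
    ultimately show ?thesis
      using Y(1) Yc[OF that] x(1) unfolding midpoint_closed_def by (meson inv_closed m_closed)
  qed
  have even: "x [^] l \<in> N" if "even l" for l :: int
  proof -
    from that obtain t where "l = 2 * t" by blast
    then have "x [^] l = (x [^] (2::nat)) [^] t" using x(1) by (simp add: int_pow_pow flip: int_pow_int)
    then show ?thesis using subgroup_int_pow[OF N.subgroup_axioms x(2)] by simp
  qed
  obtain n l where n: "n \<in> N" and a: "a = n \<otimes> x [^] (l::int)"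
    using a unfolding mem_adjoin_iff[OF x(1)] by blast
  have nc: "n \<in> carrier G" using n by (rule N.mem_carrier)
  show ?thesis
  proof (cases "even l")
    case True
    then show ?thesis using Y(2) y n even[OF True] subgroup.m_closed[OF N.subgroup_axioms] unfolding a by blast
  next
    case False
    have "x [^] l = x [^] (1::int) \<otimes> x [^] (l - 1)" using int_pow_mult[OF x(1), of 1 "l - 1"] by simp
    then have "y \<otimes> a = y \<otimes> n \<otimes> x \<otimes> x [^] (l - 1)"
      using Yc[OF y] nc x(1) by (simp add: a m_assoc)
    moreover have "x [^] (l - 1) \<in> N" using False by (intro even) simp
    ultimately show ?thesis using Y(2) step y n by simp
  qed
qed

text \<open>Carrying a subgroup \<open>N\<close> under which \<open>Y\<close> is saturated lets the
  induction climb a central series; the trivial subgroup is the starting point for arbitrary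
  \<open>Y\<close>.\<close>

lemma midpoint_closed_card_bound:
  assumes nil: "nilpotent_group G" and fin: "finite (carrier G)"
    and "N \<lhd> G" "midpoint_closed G Y" "\<forall>y \<in> Y. \<forall>n \<in> N. y \<otimes> n \<in> Y"
      "Y \<noteq> {}" "Y \<noteq> carrier G"
  shows "\<exists>q. prime q \<and> odd q \<and> q dvd order G \<and> q * card Y \<le> order G"
  using assms(3-)
proof (induction "order G - card N" arbitrary: N Y rule: less_induct)
  case less
  interpret N: normal N G by (fact less.prems(1))
  note Y = less.prems(2) and sat = less.prems(3)
  have Yc: "Y \<subseteq> carrier G" using Y by (simp add: midpoint_closed_def)
  have finY: "finite Y" using Yc fin by (rule finite_subset)
  have "N \<noteq> carrier G"
  proof
    assume N: "N = carrier G"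
    obtain y where y: "y \<in> Y" using less.prems(4) by blast
    have "h \<in> Y" if "h \<in> carrier G" for h
      using sat[rule_format, OF y, of "inv y \<otimes> h"] y Yc that by (simp add: N inv_cancel subsetD)
    then show False using Yc less.prems(5) by blast
  qed
  then obtain x0 where x0: "x0 \<in> central_mod G N" "x0 \<notin> N"
    using nilpotent_central_mod[OF nil N.normal_axioms] by blast
  then have "x0 \<in> carrier G" by (simp add: central_mod_def)
  moreover have "x0 [^] order G \<in> N" using \<open>x0 \<in> carrier G\<close> by (simp add: pow_order_eq_1)
  moreover have "order G > 0" using fin by (simp add: order_gt_0_iff_finite)
  ultimately obtain e q where q: "prime q"
    and x': "x0 [^] (e::nat) \<notin> N" "(x0 [^] e) [^] (q::nat) \<in> N"
    using prime_power_mod_subgroup[OF N.subgroup_axioms _ x0(2)] by blast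
  define x where "x = x0 [^] e"
  have x: "x \<in> central_mod G N" "x \<notin> N" "x [^] q \<in> N"
    using x' subgroup_int_pow[OF subgroup_central_mod[OF N.normal_axioms] x0(1), of "int e"]
    by (simp_all add: x_def int_pow_int)
  have xc: "x \<in> carrier G" using x by (simp add: central_mod_def)
  define N' where "N' = adjoin G N x"
  have N': "N' \<lhd> G" unfolding N'_def by (rule normal_adjoin[OF N.normal_axioms x(1)])
  have "card N' \<le> order G"
    using N' fin by (auto simp: order_def intro!: card_mono dest!: normal_imp_subgroup subgroup.subset)
  moreover have "card N' = q * card N"
    unfolding N'_def by (rule card_adjoin[OF N.subgroup_axioms xc x(2,3) q])
  moreover have "card N > 0"
    using N.subset fin N.one_closed by (metis card_gt_0_iff empty_iff finite_subset)
  moreover have "card N < q * card N" using \<open>card N > 0\<close> prime_gt_1_nat[OF q] by simp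
  ultimately have smaller: "order G - card N' < order G - card N" by linarith
  note IH = less.hyps[OF smaller N']
  show ?case
  proof (cases "q = 2")
    case True
    show ?thesis
    proof (rule IH[OF Y _ less.prems(4,5)], intro ballI)
      fix y n assume "y \<in> Y" "n \<in> N'"
      then show "y \<otimes> n \<in> Y"
        using saturated_involution[OF N.normal_axioms Y sat xc] x(3) by (simp add: N'_def True)
    qed
  next
    case False
    then have odd: "odd q" using q primes_dvd_imp_eq two_is_prime_nat by blast
    note mid = saturated_midpoint[OF N.normal_axioms Y sat x(1,3)]
    \<comment> \<open>As \<open>Y\<close> is saturated under \<open>N\<close>, this is the union of
      the left cosets of \<open>N'\<close> that meet \<open>Y\<close>.\<close>
    define Y' where "Y' = {u \<in> carrier G. \<exists>i::int. u \<otimes> x [^] i \<in> Y}"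
    have "Y \<subseteq> Y'"
    proof
      fix y assume "y \<in> Y"
      then have "y \<otimes> x [^] (0::int) \<in> Y" "y \<in> carrier G" using Yc by auto
      then show "y \<in> Y'" unfolding Y'_def by blast
    qed
    show ?thesis
    proof (cases "Y' = carrier G")
      case False
      have "midpoint_closed G Y'"
        unfolding midpoint_closed_def
      proof (intro conjI ballI impI)
        fix u g assume ug: "u \<in> carrier G" "g \<in> carrier G" and "u \<otimes> g \<in> Y'" "u \<otimes> inv g \<in> Y'"
        then obtain i j where ij: "u \<otimes> g \<otimes> x [^] (i::int) \<in> Y" "u \<otimes> inv g \<otimes> x [^] (j::int) \<in> Y"
          by (auto simp: Y'_def)
        \<comment> \<open>\<open>h\<close> is inverse to 2 modulo \<open>q\<close>, so
          \<open>(i + j) * h\<close> is a midpoint of the exponents.\<close>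
        obtain h where h: "int q + 1 = 2 * h" using odd by (metis even_of_nat odd_even_add odd_one evenE)
        have "2 * ((i + j) * h) = (i + j) + int q * (i + j)"
          using arg_cong[OF h, of "\<lambda>z. z * (i + j)"] by (simp add: algebra_simps)
        then have "[2 * ((i + j) * h) = i + j] (mod int q)"
          by (simp add: cong_iff_dvd_diff)
        from mid[OF ug ij this] show "u \<in> Y'" using ug by (auto simp: Y'_def)
      qed (auto simp: Y'_def)
      moreover have "\<forall>u \<in> Y'. \<forall>a \<in> N'. u \<otimes> a \<in> Y'"
      proof (intro ballI)
        fix u a assume ua: "u \<in> Y'" "a \<in> N'"
        obtain n l where n: "n \<in> N" and a: "a = n \<otimes> x [^] (l::int)"
          using ua(2) unfolding N'_def mem_adjoin_iff[OF xc] by blast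
        obtain i where i: "u \<otimes> x [^] (i::int) \<in> Y" and u: "u \<in> carrier G"
          using ua(1) by (auto simp: Y'_def)
        have nc: "n \<in> carrier G" using n by (rule N.mem_carrier)
        have "u \<otimes> x [^] i \<otimes> n \<in> Y" using sat i n by blast
        then have "u \<otimes> n \<otimes> x [^] i \<in> Y"
          using saturated_swap[OF N.normal_axioms Yc sat, of n u "x [^] i"] u xc n
            normal_subset_central_mod[OF N.normal_axioms] by auto
        also have "u \<otimes> n \<otimes> x [^] i = u \<otimes> a \<otimes> x [^] (i - l)"
          using u nc xc by (simp add: a m_assoc flip: int_pow_mult)
        finally show "u \<otimes> a \<in> Y'" using u nc xc by (auto simp: Y'_def a)
      qed
      moreover have "Y' \<noteq> {}" using less.prems(4) \<open>Y \<subseteq> Y'\<close> by blast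
      ultimately obtain r where r: "prime r" "odd r" "r dvd order G" "r * card Y' \<le> order G"
        using IH[of Y'] False by blast
      have "card Y \<le> card Y'"
        using \<open>Y \<subseteq> Y'\<close> fin by (intro card_mono) (auto simp: Y'_def)
      then have "r * card Y \<le> order G" using r(4) by (meson le_trans mult_le_mono2)
      then show ?thesis using r by blast
    next
      case True
      \<comment> \<open>Two exponents in different classes modulo \<open>q\<close> would, by
        \<open>midpoint_closed_integers\<close>, put all points \<open>y \<otimes> x [^] k\<close>
        into \<open>Y\<close>, and then \<open>Y\<close> would be the whole group.\<close>
      have dvd: "int q dvd i" if y: "y \<in> Y" and i: "y \<otimes> x [^] (i::int) \<in> Y" for y i
      proof (rule ccontr)
        assume ndvd: "\<not> int q dvd i"
        have yc: "y \<in> carrier G" using y Yc by blast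
        have full: "y \<otimes> x [^] k \<in> Y" for k :: int
        proof -
          have "k \<in> {k. y \<otimes> x [^] k \<in> Y}"
          proof (rule midpoint_closed_integers[OF q odd, where a = 0 and b = i])
            show "k \<in> {k. y \<otimes> x [^] k \<in> Y}"
              if "i \<in> {k. y \<otimes> x [^] k \<in> Y}" "j \<in> {k. y \<otimes> x [^] k \<in> Y}" "[2 * k = i + j] (mod int q)"
              for i j k
              using mid[OF yc one_closed _ _ that(3)] that(1,2) yc xc by simp
          qed (use y i yc ndvd in auto)
          then show ?thesis by simp
        qed
        have "h \<in> Y" if h: "h \<in> carrier G" for h
        proof -
          \<comment> \<open>This is the reflection of \<open>y\<close> in \<open>h\<close>. Some
            exponent \<open>j\<close> moves it into \<open>Y\<close>; on the side of
            \<open>y\<close> every exponent is available, so \<open>- j\<close> can be chosen, and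
            the midpoint with exponent 0 is \<open>h\<close>.\<close>
          have "h \<otimes> inv (inv h \<otimes> y) \<in> Y'" using True h yc by simp
          then obtain j where j: "h \<otimes> inv (inv h \<otimes> y) \<otimes> x [^] (j::int) \<in> Y"
            by (auto simp: Y'_def)
          have "h \<otimes> (inv h \<otimes> y) \<otimes> x [^] (- j) \<in> Y"
            using full h yc by (simp add: inv_cancel)
          from mid[OF h _ this j, of 0] show ?thesis using h yc by simp
        qed
        then show False using Yc less.prems(5) by blast
      qed
      \<comment> \<open>By \<open>dvd\<close>, the right translates of \<open>Y\<close> by the
        \<open>q\<close> powers of \<open>x\<close> are disjoint.\<close>
      have "inj_on (\<lambda>(y, i). y \<otimes> x [^] i) (Y \<times> {0..<int q})"
      proof (rule inj_onI, clarsimp)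
        fix y y' and i j :: int
        assume *: "y \<in> Y" "y' \<in> Y" "0 \<le> i" "i < int q" "0 \<le> j" "j < int q"
          and eq: "y \<otimes> x [^] i = y' \<otimes> x [^] j"
        have yc: "y \<in> carrier G" "y' \<in> carrier G" using * Yc by auto
        have "y \<otimes> x [^] (i - j) = (y \<otimes> x [^] i) \<otimes> inv (x [^] j)"
          using yc xc by (simp add: int_pow_diff m_assoc)
        also have "\<dots> = y'" unfolding eq using yc xc by (simp add: m_assoc)
        finally have "int q dvd i - j" using dvd * by metis
        then have "i = j" using * by (metis mod_eq_dvd_iff mod_pos_pos_trivial)
        then show "y = y' \<and> i = j" using eq yc xc by simp
      qed
      moreover have "(\<lambda>(y, i). y \<otimes> x [^] i) ` (Y \<times> {0..<int q}) \<subseteq> carrier G"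
        using Yc xc by auto
      ultimately have "card (Y \<times> {0..<int q}) \<le> order G"
        unfolding order_def using fin by (rule card_inj_on_le)
      then have "q * card Y \<le> order G" by (simp add: card_cartesian_product mult.commute)
      then show ?thesis
        using q odd prime_dvd_order[OF N.subgroup_axioms xc x(2,3) q] by blast
    qed
  qed
qed


text \<open>Translation by \<open>inv t\<close> turns the coset into \<open>M\<close> and
  \<open>u\<close> into \<open>v\<close>. The two moves yield \<open>v [^] 2 \<in> M\<close>, the
  index yields \<open>v [^] p \<in> M\<close>, and \<open>p\<close> is odd.\<close>

lemma midpoint_closed_left_coset:
  assumes M: "M \<lhd> G" and fin: "finite (carrier G)" and p: "odd p" "p * card M = order G"
    and t: "t \<in> carrier G"
  shows "midpoint_closed G (t <# M)"
proof -
  interpret M: normal M G by (fact M)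
  have mem: "z \<in> t <# M \<longleftrightarrow> inv t \<otimes> z \<in> M" if "z \<in> carrier G" for z
  proof
    assume "z \<in> t <# M"
    then show "inv t \<otimes> z \<in> M" using t M.mem_carrier by (auto simp: l_coset_def inv_cancel)
  next
    assume "inv t \<otimes> z \<in> M"
    then have "t \<otimes> (inv t \<otimes> z) \<in> t <# M" unfolding l_coset_def by blast
    then show "z \<in> t <# M" using t that by (simp add: inv_cancel)
  qed
  have "card M > 0"
    using M.subset fin M.one_closed by (metis card_gt_0_iff empty_iff finite_subset)
  then have index: "order G div card M = p" using p(2) by (metis nonzero_mult_div_cancel_right less_irrefl)
  show ?thesis
    unfolding midpoint_closed_def
  proof (intro conjI ballI impI)
    show "t <# M \<subseteq> carrier G" using t M.subset by (auto simp: l_coset_def)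
    fix u g assume ug: "u \<in> carrier G" "g \<in> carrier G" and "u \<otimes> g \<in> t <# M" "u \<otimes> inv g \<in> t <# M"
    define v where "v = inv t \<otimes> u"
    have v: "v \<in> carrier G" using t ug by (simp add: v_def)
    have "v \<otimes> g \<in> M" and v2: "v \<otimes> inv g \<in> M"
      using \<open>u \<otimes> g \<in> t <# M\<close> \<open>u \<otimes> inv g \<in> t <# M\<close> t ug by (simp_all add: mem v_def m_assoc)
    \<comment> \<open>This conjugate equals \<open>g \<otimes> v\<close>, so multiplying it on the
      left by \<open>v \<otimes> inv g\<close> gives \<open>v [^] 2\<close>.\<close>
    then have "inv v \<otimes> (v \<otimes> g) \<otimes> v \<in> M" using v by (intro M.inv_op_closed1)
    then have "v \<otimes> inv g \<otimes> (inv v \<otimes> (v \<otimes> g) \<otimes> v) \<in> M" using v2 by simp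
    then have "v [^] (2::nat) \<in> M"
      using v ug by (simp add: m_assoc inv_cancel numeral_2_eq_2)
    moreover have "v [^] p \<in> M" using pow_index_mem[OF M fin v] by (simp add: index)
    ultimately have "v \<in> M"
      using coprime_pow_mem[OF M.subgroup_axioms v] p(1) by simp
    then show "u \<in> t <# M" using ug by (simp add: mem v_def)
  qed
qed

end

section \<open>The value of the game\<close>

lemma ex_odd_prime_divisor:
  assumes "n > 0" "\<nexists>k. n = 2 ^ k"
  shows "\<exists>p::nat. prime p \<and> odd p \<and> p dvd n"
proof -
  obtain m where n: "n = 2 ^ multiplicity 2 n * m" and m: "odd m"
    by (rule multiplicity_decompose'[of n 2]) (use assms(1) in auto)
  have "m \<noteq> 1" using n assms(2) by (metis mult.right_neutral)
  then obtain p where "prime p" "p dvd m" using prime_factor_nat by blast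
  moreover have "p dvd n" using \<open>p dvd m\<close> by (subst n) simp
  ultimately show ?thesis using m by (meson dvd_trans)
qed

theorem theorem1p6:
  fixes G :: "('a, 'b) monoid_scheme" and s :: 'a
  assumes "nilpotent_group G"
    and "finite (carrier G)"
    and "s \<in> carrier G"
  shows "real (visited_number G s) = f_star (order G)"
proof -
  interpret group G using assms(1) by (simp add: nilpotent_group_def)
  have bound: "\<exists>q. prime q \<and> odd q \<and> q dvd order G \<and> q * card Y \<le> order G"
    if "midpoint_closed G Y" "0 < card Y" "Y \<noteq> carrier G" for Y
  proof (rule midpoint_closed_card_bound[OF assms(1,2) one_is_normal that(1) _ _ that(3)])
    have "Y \<subseteq> carrier G" using that(1) by (simp add: midpoint_closed_def)
    then show "\<forall>y \<in> Y. \<forall>n \<in> {\<one>\<^bsub>G\<^esub>}. y \<otimes>\<^bsub>G\<^esub> n \<in> Y" by (simp add: subset_iff)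
    show "Y \<noteq> {}" using that(2) by auto
  qed
  show ?thesis
  proof (cases "\<exists>k. order G = 2 ^ k")
    case True
    \<comment> \<open>No odd prime divides a power of 2, so the bound leaves only the empty set as a
      proper midpoint-closed set, and Explorer visits everything.\<close>
    have "Y = carrier G" if Y: "midpoint_closed G Y" "card ({} :: 'a set) < card Y" for Y
    proof (rule ccontr)
      assume "Y \<noteq> carrier G"
      then obtain q where "prime q" "odd q" "q dvd order G" using bound[OF Y(1)] Y(2) by auto
      moreover from True obtain k where "order G = 2 ^ k" by blast
      ultimately have "q dvd 2" by (metis prime_dvd_power)
      then show False
        using primes_dvd_imp_eq[OF \<open>prime q\<close> two_is_prime_nat] \<open>odd q\<close> by simp
    qed
    moreover have "midpoint_closed G {}" by (simp add: midpoint_closed_def)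
    ultimately have "visited_number G s = order G - card ({} :: 'a set)"
      by (rule visited_number_eqI[OF assms(2,3)]) simp_all
    then show ?thesis using True by (simp add: f_star_def)
  next
    case False
    define p where "p = (LEAST p. prime p \<and> odd p \<and> p dvd order G)"
    have "order G > 0" using assms(2) by (simp add: order_gt_0_iff_finite)
    then have p: "prime p" "odd p" "p dvd order G"
      using LeastI_ex[OF ex_odd_prime_divisor[OF _ False]] by (simp_all add: p_def)
    obtain M where M: "M \<lhd> G" "p * card M = order G"
      using nilpotent_normal_index_prime[OF assms(1,2) p(1,3)] by blast
    interpret M: normal M G by (fact M(1))
    have "M \<noteq> carrier G"
      using M(2) \<open>order G > 0\<close> prime_gt_1_nat[OF p(1)] by (auto simp: order_def)
    then obtain a where a: "a \<in> carrier G" "a \<notin> M" using M.subset by blast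
    \<comment> \<open>The coset that Director avoids; it misses \<open>s\<close> because
      \<open>a \<notin> M\<close>.\<close>
    define Z where "Z = (s \<otimes>\<^bsub>G\<^esub> a) <#\<^bsub>G\<^esub> M"
    have Z: "midpoint_closed G Z"
      unfolding Z_def using assms a by (intro midpoint_closed_left_coset[OF M(1) _ p(2) M(2)]) auto
    have "s \<notin> Z"
    proof
      assume "s \<in> Z"
      then obtain m where m: "m \<in> M" "s = s \<otimes>\<^bsub>G\<^esub> a \<otimes>\<^bsub>G\<^esub> m" by (auto simp: Z_def l_coset_def)
      have mc: "m \<in> carrier G" using m(1) by (rule M.mem_carrier)
      have "s \<otimes>\<^bsub>G\<^esub> (a \<otimes>\<^bsub>G\<^esub> m) = s"
        using m(2)[symmetric] assms(3) a(1) mc by (simp flip: m_assoc)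
      then have "a \<otimes>\<^bsub>G\<^esub> m = \<one>\<^bsub>G\<^esub>"
        using assms(3) a(1) mc by simp
      then have "a = inv\<^bsub>G\<^esub> m" using a(1) mc by (simp add: inv_equality)
      then show False using a(2) m(1) by simp
    qed
    have cardZ: "card Z = card M"
    proof -
      have "Z = (\<lambda>m. s \<otimes>\<^bsub>G\<^esub> a \<otimes>\<^bsub>G\<^esub> m) ` M" by (auto simp: Z_def l_coset_def)
      then show ?thesis using assms(3) a(1) M.mem_carrier by (simp add: card_image inj_on_def)
    qed
    \<comment> \<open>The bound comes with some odd prime \<open>q\<close>; since \<open>p\<close>
      is the least one, \<open>card Y\<close> is at most \<open>order G\<close> divided by
      \<open>p\<close>, which is \<open>card M\<close>.\<close>
    have "Y = carrier G" if Y: "midpoint_closed G Y" "card Z < card Y" for Y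
    proof (rule ccontr)
      assume "Y \<noteq> carrier G"
      then obtain q where q: "prime q" "odd q" "q dvd order G" "q * card Y \<le> order G"
        using bound[OF Y(1)] Y(2) by force
      have "p \<le> q" unfolding p_def using q by (intro Least_le) simp
      have "order G < p * card Y" using Y(2) cardZ prime_gt_0_nat[OF p(1)] by (simp flip: M(2))
      also have "\<dots> \<le> q * card Y" using \<open>p \<le> q\<close> by simp
      finally show False using q(4) by simp
    qed
    then have "visited_number G s = order G - card Z"
      using Z \<open>s \<notin> Z\<close> by (rule visited_number_eqI[OF assms(2,3)])
    also have "\<dots> = p * card M - card M" by (simp add: cardZ M(2))
    finally have "real (visited_number G s) = real p * real (card M) - real (card M)"
      using prime_gt_0_nat[OF p(1)] by (simp add: of_nat_diff)
    moreover have "real (order G) = real p * real (card M)" by (simp flip: M(2))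
    ultimately show ?thesis
      using False prime_gt_0_nat[OF p(1)] by (simp add: f_star_def flip: p_def) (simp add: field_simps)
  qed
qed

end
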